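(* Let $a$ and $b$ be positive integers with $b\geq\max\{a,3\}$, and let $G$ be a connected graph of order $n$ with $n\geq\max\{a+2,7\}$. If $$q(G)>2n-4+\frac{a+1}{n-1}\quad\text{and}\quad q(G)>q(K_a\vee(K_{n-a-1}\cup K_1)),$$ then $G$ is a fractional $[a,b]$-deleted graph.
   Context: All graphs are finite, undirected, without loops or multiple edges. $q(G)$ denotes the signless Laplacian spectral radius of $G$, i.e. the largest eigenvalue of $Q(G)=D(G)+A(G)$, where $D(G)$ is the diagonal degree matrix and $A(G)$ the adjacency matrix. $K_m$ is the complete graph on $m$ vertices, $G_1\cup G_2$ is the disjoint union, and $G_1\vee G_2$ is the join (disjoint union plus all edges between a vertex of $G_1$ and a vertex of $G_2$). For a vertex $v$, $E_G(v)$ denotes the set of edges incident with $v$. For positive integers $a\leq b$, a fractional $[a,b]$-factor of $G$ is given by a function $h:E(G)\to[0,1]$ such that $a\leq\sum_{e\in E_G(v)}h(e)\leq b$ for every $v\in V(G)$. $G$ is called a fractional $[a,b]$-deleted graph if for every edge $e\in E(G)$, the graph $G-e$ has a fractional $[a,b]$-factor. *)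

theory Defs
  imports Complex_Main "Jordan_Normal_Form.Spectral_Radius"
begin

record 'a graph =
  verts :: "'a set"
  edges :: "'a set set"

definition simple_graph :: "'a graph \<Rightarrow> bool" where
  "simple_graph G \<longleftrightarrow> finite (verts G) \<and> (\<forall>e\<in>edges G. e \<subseteq> verts G \<and> card e = 2)"

definition graph_order :: "'a graph \<Rightarrow> nat" where
  "graph_order G = card (verts G)"

definition connected_graph :: "'a graph \<Rightarrow> bool" where
  "connected_graph G \<longleftrightarrow> verts G \<noteq> {} \<and>
     (\<forall>u\<in>verts G. \<forall>v\<in>verts G. (u, v) \<in> {(x, y). {x, y} \<in> edges G}\<^sup>*)"

definition incident_edges :: "'a graph \<Rightarrow> 'a \<Rightarrow> 'a set set" where
  "incident_edges G v = {e \<in> edges G. v \<in> e}"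

definition delete_edge :: "'a graph \<Rightarrow> 'a set \<Rightarrow> 'a graph" where
  "delete_edge G e = \<lparr>verts = verts G, edges = edges G - {e}\<rparr>"

definition complete_graph :: "nat \<Rightarrow> nat graph" where
  "complete_graph m = \<lparr>verts = {..<m}, edges = {e. e \<subseteq> {..<m} \<and> card e = 2}\<rparr>"

definition disjoint_union :: "'a graph \<Rightarrow> 'b graph \<Rightarrow> ('a + 'b) graph" where
  "disjoint_union G H =
     \<lparr>verts = verts G <+> verts H,
      edges = (\<lambda>e. Inl ` e) ` edges G \<union> (\<lambda>e. Inr ` e) ` edges H\<rparr>"

definition graph_join :: "'a graph \<Rightarrow> 'b graph \<Rightarrow> ('a + 'b) graph" where
  "graph_join G H =
     \<lparr>verts = verts G <+> verts H,
      edges = edges (disjoint_union G H) \<union> {{Inl u, Inr v} | u v. u \<in> verts G \<and> v \<in> verts H}\<rparr>"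

text \<open>Matrices are indexed by natural numbers, so the rows and columns are labelled by a list
  enumerating the vertices. The spectrum of the signless Laplacian matrix does not depend on the
  enumeration, see \<open>spectrum_signless_laplacian\<close> below.\<close>

definition adjacency_matrix :: "'a graph \<Rightarrow> 'a list \<Rightarrow> real mat" where
  "adjacency_matrix G vs =
     mat (length vs) (length vs) (\<lambda>(i, j). if {vs ! i, vs ! j} \<in> edges G then 1 else 0)"

definition degree_matrix :: "'a graph \<Rightarrow> 'a list \<Rightarrow> real mat" where
  "degree_matrix G vs =
     mat (length vs) (length vs)
       (\<lambda>(i, j). if i = j then real (card (incident_edges G (vs ! i))) else 0)"

definition signless_laplacian :: "'a graph \<Rightarrow> 'a list \<Rightarrow> real mat" where
  "signless_laplacian G vs = degree_matrix G vs + adjacency_matrix G vs"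

definition vertex_enum :: "'a graph \<Rightarrow> 'a list" where
  "vertex_enum G = (SOME vs. distinct vs \<and> set vs = verts G)"

definition signless_radius :: "'a graph \<Rightarrow> real" where
  "signless_radius G = Max (spectrum (signless_laplacian G (vertex_enum G)))"

definition fractional_factor :: "nat \<Rightarrow> nat \<Rightarrow> 'a graph \<Rightarrow> ('a set \<Rightarrow> real) \<Rightarrow> bool" where
  "fractional_factor a b G h \<longleftrightarrow>
     (\<forall>e\<in>edges G. 0 \<le> h e \<and> h e \<le> 1) \<and>
     (\<forall>v\<in>verts G. real a \<le> (\<Sum>e\<in>incident_edges G v. h e) \<and>
                   (\<Sum>e\<in>incident_edges G v. h e) \<le> real b)"

definition fractional_deleted :: "nat \<Rightarrow> nat \<Rightarrow> 'a graph \<Rightarrow> bool" where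
  "fractional_deleted a b G \<longleftrightarrow> (\<forall>e\<in>edges G. \<exists>h. fractional_factor a b (delete_edge G e) h)"

lemma vertex_enum:
  assumes "simple_graph G"
  shows "distinct (vertex_enum G)" "set (vertex_enum G) = verts G"
proof -
  have "finite (verts G)"
    using assms by (simp add: simple_graph_def)
  then obtain vs where "set vs = verts G" "distinct vs"
    using finite_distinct_list by metis
  hence "distinct vs \<and> set vs = verts G" by simp
  hence *: "distinct (vertex_enum G) \<and> set (vertex_enum G) = verts G"
    unfolding vertex_enum_def by (rule someI)
  show "distinct (vertex_enum G)" using * by (rule conjunct1)
  show "set (vertex_enum G) = verts G" using * by (rule conjunct2)
qed

lemma signless_laplacian_carrier:
  "signless_laplacian G vs \<in> carrier_mat (length vs) (length vs)"
  by (simp add: signless_laplacian_def adjacency_matrix_def degree_matrix_def)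

lemma signless_laplacian_dim [simp]:
  "dim_row (signless_laplacian G vs) = length vs"
  "dim_col (signless_laplacian G vs) = length vs"
  by (simp_all add: signless_laplacian_def adjacency_matrix_def degree_matrix_def)

lemma signless_laplacian_index:
  assumes "i < length vs" "j < length vs"
  shows "signless_laplacian G vs $$ (i, j) =
     (if i = j then real (card (incident_edges G (vs ! i))) else 0) +
     (if {vs ! i, vs ! j} \<in> edges G then 1 else 0)"
  using assms by (simp add: signless_laplacian_def adjacency_matrix_def degree_matrix_def)

lemma sum_list_index:
  assumes "distinct vs"
  shows "(\<Sum>j<length vs. f (vs ! j)) = sum f (set vs)"
proof -
  have "bij_betw ((!) vs) {..<length vs} (set vs)"
    using bij_betw_nth[OF assms refl refl] .
  thus ?thesis by (rule sum.reindex_bij_betw)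
qed

lemma signless_laplacian_mult:
  assumes "distinct vs" "i < length vs"
  shows "(signless_laplacian G vs *\<^sub>v vec (length vs) (\<lambda>j. x (vs ! j))) $ i =
     real (card (incident_edges G (vs ! i))) * x (vs ! i) +
     (\<Sum>w\<in>set vs. if {vs ! i, w} \<in> edges G then x w else 0)"
proof -
  let ?n = "length vs"
  have "(signless_laplacian G vs *\<^sub>v vec ?n (\<lambda>j. x (vs ! j))) $ i =
     (\<Sum>j<?n. signless_laplacian G vs $$ (i, j) * x (vs ! j))"
    using assms(2) by (simp add: scalar_prod_def lessThan_atLeast0)
  also have "\<dots> = (\<Sum>j<?n. (if i = j then real (card (incident_edges G (vs ! i))) * x (vs ! i) else 0) +
     (if {vs ! i, vs ! j} \<in> edges G then x (vs ! j) else 0))"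
  proof (rule sum.cong[OF refl])
    fix j assume "j \<in> {..<?n}"
    thus "signless_laplacian G vs $$ (i, j) * x (vs ! j) =
      (if i = j then real (card (incident_edges G (vs ! i))) * x (vs ! i) else 0) +
      (if {vs ! i, vs ! j} \<in> edges G then x (vs ! j) else 0)"
      using assms(2) by (cases "i = j") (simp_all add: signless_laplacian_index distrib_right)
  qed
  also have "\<dots> = real (card (incident_edges G (vs ! i))) * x (vs ! i) +
     (\<Sum>j<?n. if {vs ! i, vs ! j} \<in> edges G then x (vs ! j) else 0)"
    using assms(2) by (simp add: sum.distrib sum.delta)
  also have "(\<Sum>j<?n. if {vs ! i, vs ! j} \<in> edges G then x (vs ! j) else 0) =
     (\<Sum>w\<in>set vs. if {vs ! i, w} \<in> edges G then x w else 0)"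
    by (rule sum_list_index[OF assms(1), of "\<lambda>w. if {vs ! i, w} \<in> edges G then x w else 0"])
  finally show ?thesis .
qed

lemma spectrum_signless_laplacian:
  assumes "distinct vs" "set vs = verts G"
  shows "spectrum (signless_laplacian G vs) =
    {k. \<exists>x. (\<exists>v\<in>verts G. x v \<noteq> 0) \<and>
       (\<forall>v\<in>verts G. real (card (incident_edges G v)) * x v +
          (\<Sum>w\<in>verts G. if {v, w} \<in> edges G then x w else 0) = k * x v)}"
    (is "?L = ?R")
proof -
  let ?n = "length vs" and ?A = "signless_laplacian G vs"
  show ?thesis
  proof (intro equalityI subsetI)
    fix k assume "k \<in> ?L"
    then obtain y where y: "y \<in> carrier_vec ?n" "y \<noteq> 0\<^sub>v ?n" "?A *\<^sub>v y = k \<cdot>\<^sub>v y"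
      by (auto simp: spectrum_def eigenvalue_def eigenvector_def)
    define x where "x v = y $ (THE i. i < ?n \<and> vs ! i = v)" for v
    have x: "x (vs ! i) = y $ i" if "i < ?n" for i
    proof -
      have "(THE j. j < ?n \<and> vs ! j = vs ! i) = i"
        by (rule the_equality) (use that assms(1) nth_eq_iff_index_eq in blast)+
      thus ?thesis by (simp add: x_def)
    qed
    have yx: "y = vec ?n (\<lambda>j. x (vs ! j))"
      by (rule eq_vecI) (use y(1) x in simp_all)
    have "\<exists>i<?n. y $ i \<noteq> 0" using y(1,2) by auto
    then obtain i where "i < ?n" "y $ i \<noteq> 0" by blast
    hence 1: "vs ! i \<in> verts G" "x (vs ! i) \<noteq> 0" using x nth_mem[of i vs] assms(2) by simp_all
    have 2: "real (card (incident_edges G v)) * x v +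
          (\<Sum>w\<in>verts G. if {v, w} \<in> edges G then x w else 0) = k * x v" if v: "v \<in> verts G" for v
    proof -
      obtain i where i: "i < ?n" "vs ! i = v" using v assms(2) in_set_conv_nth[of v vs] by blast
      have "(?A *\<^sub>v y) $ i = k * x v" using y(1) i x[OF i(1)] by (simp add: y(3))
      thus ?thesis
        using signless_laplacian_mult[OF assms(1) i(1), of G x, folded yx, unfolded i(2) assms(2)]
        by (rule trans[OF sym, rotated])
    qed
    show "k \<in> ?R" by (rule CollectI, rule exI[of _ x]) (use 1 2 in blast)
  next
    fix k assume "k \<in> ?R"
    then obtain x where x: "\<exists>v\<in>verts G. x v \<noteq> 0"
      "\<forall>v\<in>verts G. real (card (incident_edges G v)) * x v +
          (\<Sum>w\<in>verts G. if {v, w} \<in> edges G then x w else 0) = k * x v" by blast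
    define y where "y = vec ?n (\<lambda>j. x (vs ! j))"
    obtain v where v: "v \<in> verts G" "x v \<noteq> 0" using x(1) by blast
    obtain i where i: "i < ?n" "vs ! i = v" using v(1) assms(2) in_set_conv_nth[of v vs] by blast
    have "y $ i \<noteq> 0" using v(2) i by (simp add: y_def)
    hence "y \<noteq> 0\<^sub>v ?n" using i(1) by auto
    moreover have "?A *\<^sub>v y = k \<cdot>\<^sub>v y"
    proof (rule eq_vecI)
      fix i assume "i < dim_vec (k \<cdot>\<^sub>v y)"
      hence i: "i < ?n" by (simp add: y_def)
      have "vs ! i \<in> verts G" using nth_mem[OF i] unfolding assms(2) .
      from x(2)[rule_format, OF this] have "(?A *\<^sub>v y) $ i = k * x (vs ! i)"
        using signless_laplacian_mult[OF assms(1) i, of G x, folded y_def, unfolded assms(2)]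
        by (rule trans[rotated])
      thus "(?A *\<^sub>v y) $ i = (k \<cdot>\<^sub>v y) $ i"
        using i by (simp add: y_def)
    qed (simp add: y_def)
    moreover have "y \<in> carrier_vec ?n" by (simp add: y_def)
    ultimately have "eigenvector ?A y k"
      by (simp add: eigenvector_def)
    thus "k \<in> ?L"
      unfolding spectrum_def eigenvalue_def by blast
  qed
qed

text \<open>The maximum in \<open>signless_radius\<close> is taken over a finite and nonempty set.\<close>

lemma finite_spectrum_signless_laplacian: "finite (spectrum (signless_laplacian G vs))"
  using card_finite_spectrum(1)[OF signless_laplacian_carrier] .

lemma signless_laplacian_sym:
  assumes "i < length vs" "j < length vs"
  shows "signless_laplacian G vs $$ (i, j) = signless_laplacian G vs $$ (j, i)"
  unfolding signless_laplacian_index[OF assms] signless_laplacian_index[OF assms(2,1)]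
    insert_commute[of "vs ! j" "vs ! i"] by (cases "i = j") simp_all

lemma spectrum_signless_laplacian_nonempty:
  assumes "vs \<noteq> []"
  shows "spectrum (signless_laplacian G vs) \<noteq> {}"
proof -
  let ?n = "length vs" and ?A = "signless_laplacian G vs"
  let ?C = "map_mat complex_of_real ?A"
  have A: "?A \<in> carrier_mat ?n ?n" by (rule signless_laplacian_carrier)
  hence C: "?C \<in> carrier_mat ?n ?n" by simp
  obtain z where z: "eigenvalue ?C z"
    using spectrum_non_empty[OF C] assms unfolding spectrum_def by blast
  then obtain y where "eigenvector ?C y z" unfolding eigenvalue_def by blast
  hence y: "y \<in> carrier_vec ?n" "y \<noteq> 0\<^sub>v ?n" "?C *\<^sub>v y = z \<cdot>\<^sub>v y"
    by (simp_all add: eigenvector_def)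
  have row: "(\<Sum>j<?n. of_real (?A $$ (i, j)) * y $ j) = z * y $ i" if "i < ?n" for i
  proof -
    have "(?C *\<^sub>v y) $ i = (\<Sum>j<?n. of_real (?A $$ (i, j)) * y $ j)"
      using that y(1) by (simp add: scalar_prod_def lessThan_atLeast0)
    thus ?thesis using y(1) that by (simp add: y(3))
  qed
  define S where "S = (\<Sum>i<?n. \<Sum>j<?n. cnj (y $ i) * (of_real (?A $$ (i, j)) * y $ j))"
  define N where "N = (\<Sum>i<?n. (cmod (y $ i))\<^sup>2)"
  have "S = (\<Sum>i<?n. cnj (y $ i) * (z * y $ i))"
    unfolding S_def sum_distrib_left[symmetric]
    by (intro sum.cong refl arg_cong[of _ _ "(*) _"]) (simp only: row lessThan_iff)
  also have "\<dots> = z * of_real N"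
    unfolding N_def of_real_sum sum_distrib_left complex_norm_square
    by (intro sum.cong refl) (simp only: mult_ac)
  finally have S: "S = z * of_real N" .
  have "cnj S = (\<Sum>i<?n. \<Sum>j<?n. cnj (y $ j) * (of_real (?A $$ (j, i)) * y $ i))"
    unfolding S_def cnj_sum
  proof (intro sum.cong refl)
    fix i j assume "i \<in> {..<?n}" "j \<in> {..<?n}"
    hence "?A $$ (i, j) = ?A $$ (j, i)" by (intro signless_laplacian_sym) auto
    thus "cnj (cnj (y $ i) * (of_real (?A $$ (i, j)) * y $ j)) =
      cnj (y $ j) * (of_real (?A $$ (j, i)) * y $ i)" by simp
  qed
  also have "\<dots> = S" unfolding S_def by (rule sum.swap)
  finally have cS: "cnj S = S" .
  have "\<exists>i<?n. y $ i \<noteq> 0" using y(1,2) by auto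
  then obtain i where i: "i < ?n" "y $ i \<noteq> 0" by blast
  have "N > 0" unfolding N_def
    by (rule sum_pos2[of _ i]) (use i in auto)
  hence "cnj z = z" using cS S by simp
  then obtain r where r: "z = of_real r" by (metis Reals_cnj_iff Reals_cases)
  have "poly (char_poly ?C) z = 0" using eigenvalue_root_char_poly[OF C] z by simp
  hence "poly (char_poly ?A) r = 0"
    by (simp add: of_real_hom.char_poly_hom[OF A] r)
  hence "eigenvalue ?A r" using eigenvalue_root_char_poly[OF A] by simp
  thus ?thesis unfolding spectrum_def by blast
qed

end

theory Submission
  imports Defs
begin

text \<open>The first spectral hypothesis together with the bound
  q(G) \<le> 2m / (n - 1) + n - 2 says that G misses fewer than n - 1 - (a + 1)/2 edges. The second one
  forces every degree to exceed a, since a graph with a vertex of degree at most a lies inside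
  the extremal graph. Both eigenvalue comparisons test the signless Laplacian against a positive
  vector: the degrees in the first case, the Perron vector of the extremal graph in the second.

  A fractional [a,b]-factor exists if a|T| \<le> b|S| + \<Sum>v\<in>T. d_{G-S}(v) for all disjoint S and T.
  To see this, choose weights maximizing the total covered demand \<Sum>v. min(a, d_h(v)); if some vertex u
  still lacks weight, the vertices from which weight can be moved to u by infinitesimal
  alternating changes give a violating pair. For G - e the criterion follows from
  the minimum degree if |T| \<le> b, and from the number of missing edges otherwise.\<close>

section \<open>A criterion for fractional factors\<close>

definition weighted_degree :: "'v graph \<Rightarrow> ('v set \<Rightarrow> real) \<Rightarrow> 'v \<Rightarrow> real" where
  "weighted_degree G h v = (\<Sum>e\<in>incident_edges G v. h e)"

lemma weighted_degree_add:
  "weighted_degree G (\<lambda>e. g e + h e) v = weighted_degree G g v + weighted_degree G h v"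
  by (simp add: weighted_degree_def sum.distrib)

lemma weighted_degree_scale:
  "weighted_degree G (\<lambda>e. c * h e) v = c * weighted_degree G h v"
  by (simp add: weighted_degree_def sum_distrib_left)

lemma finite_edges:
  assumes "simple_graph G"
  shows "finite (edges G)"
proof -
  have "edges G \<subseteq> Pow (verts G)" using assms by (auto simp: simple_graph_def)
  thus ?thesis using assms finite_subset by (fastforce simp: simple_graph_def)
qed

lemma finite_incident_edges:
  "simple_graph G \<Longrightarrow> finite (incident_edges G v)"
  by (simp add: incident_edges_def finite_edges)

lemma edge_otherE:
  assumes "simple_graph G" "e \<in> edges G" "v \<in> e"
  obtains w where "e = {v, w}" "w \<noteq> v" "v \<in> verts G" "w \<in> verts G"
proof -
  have "card e = 2" "e \<subseteq> verts G" using assms by (auto simp: simple_graph_def)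
  then obtain x y where "e = {x, y}" "x \<noteq> y" by (meson card_2_iff)
  thus ?thesis using that[of x] that[of y] assms(3) \<open>e \<subseteq> verts G\<close> by (auto simp: insert_commute)
qed

lemma weighted_degree_indicator:
  assumes "simple_graph G" "e \<in> edges G"
  shows "weighted_degree G (\<lambda>e'. c * of_bool (e' = e)) v = c * of_bool (v \<in> e)"
proof -
  have "weighted_degree G (\<lambda>e'. c * of_bool (e' = e)) v
      = (\<Sum>e'\<in>incident_edges G v. if e' = e then c else 0)"
    unfolding weighted_degree_def by (intro sum.cong) auto
  also have "\<dots> = c * of_bool (v \<in> e)"
    using finite_incident_edges[OF assms(1)] assms(2)
    by (simp add: sum.delta) (simp add: incident_edges_def)
  finally show ?thesis .
qed

section \<open>Existence of optimal weights by compactness\<close>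

text \<open>Bolzano-Weierstrass one coordinate at a time: each new coordinate has a monotone
  subsequence, which converges by boundedness, and passing to it keeps the earlier limits.\<close>

lemma pointwise_convergent_subsequence:
  fixes f :: "nat \<Rightarrow> 'e \<Rightarrow> real"
  assumes "finite E" "\<And>n e. e \<in> E \<Longrightarrow> \<bar>f n e\<bar> \<le> M"
  shows "\<exists>r. strict_mono r \<and> (\<forall>e\<in>E. convergent (\<lambda>n. f (r n) e))"
  using assms
proof (induction E rule: finite_induct)
  case empty
  show ?case using strict_mono_id by auto
next
  case (insert e E)
  then obtain r where r: "strict_mono r" "\<forall>e\<in>E. convergent (\<lambda>n. f (r n) e)" by auto
  obtain s :: "nat \<Rightarrow> nat" where s: "strict_mono s" "monoseq (\<lambda>n. f (r (s n)) e)"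
    using seq_monosub[of "\<lambda>n. f (r n) e"] by blast
  have "Bseq (\<lambda>n. f (r (s n)) e)"
    using insert.prems by (intro BseqI'[of _ M]) auto
  hence "convergent (\<lambda>n. f (r (s n)) e)"
    using s(2) by (rule Bseq_monoseq_convergent)
  moreover have "convergent (\<lambda>n. f (r (s n)) e')" if "e' \<in> E" for e'
    using convergent_subseq_convergent[OF r(2)[rule_format, OF that] s(1)] by (simp add: o_def)
  ultimately show ?case
    using strict_mono_o[OF r(1) s(1)] by (intro exI[of _ "r \<circ> s"]) (simp add: o_def)
qed

text \<open>The lower bound a is left out, so the zero weight always qualifies; it is recovered by
  maximizing \<open>covered_demand\<close>.\<close>

definition admissible_weights :: "nat \<Rightarrow> 'v graph \<Rightarrow> ('v set \<Rightarrow> real) set" where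
  "admissible_weights b G =
    {h. (\<forall>e\<in>edges G. 0 \<le> h e \<and> h e \<le> 1) \<and> (\<forall>v\<in>verts G. weighted_degree G h v \<le> b)}"

text \<open>Truncating at a keeps a surplus at one vertex from hiding a deficit at another.\<close>

definition covered_demand :: "nat \<Rightarrow> 'v graph \<Rightarrow> ('v set \<Rightarrow> real) \<Rightarrow> real" where
  "covered_demand a G h = (\<Sum>v\<in>verts G. min a (weighted_degree G h v))"

lemma ex_max_covered_demand:
  assumes G: "simple_graph G"
  obtains h where "h \<in> admissible_weights b G"
    "\<And>g. g \<in> admissible_weights b G \<Longrightarrow> covered_demand a G g \<le> covered_demand a G h"
proof -
  let ?K = "admissible_weights b G" and ?\<phi> = "covered_demand a G"
  define M where "M = (SUP h\<in>?K. ?\<phi> h)"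
  have "(\<lambda>_. 0) \<in> ?K" by (auto simp: admissible_weights_def weighted_degree_def)
  hence ne: "?\<phi> ` ?K \<noteq> {}" by blast
  have bdd: "bdd_above (?\<phi> ` ?K)"
    by (rule bdd_aboveI[of _ "\<Sum>v\<in>verts G. real a"]) (auto simp: covered_demand_def simp del: sum_constant intro!: sum_mono)
  \<comment> \<open>A maximizing sequence; the limit of a pointwise convergent subsequence will
    attain the supremum \<open>M\<close>.\<close>
  have "\<exists>h\<in>?K. M - 1 / Suc n < ?\<phi> h" for n
    using less_cSUP_iff[OF _ bdd, of "M - 1 / Suc n"] ne by (auto simp: M_def)
  then obtain f where f: "\<And>n. f n \<in> ?K" "\<And>n. M - 1 / Suc n < ?\<phi> (f n)" by metis
  obtain r where r: "strict_mono r" "\<forall>e\<in>edges G. convergent (\<lambda>n. f (r n) e)"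
    using pointwise_convergent_subsequence[OF finite_edges[OF G], of f 1] f(1)
    by (fastforce simp: admissible_weights_def)
  define h where "h e = lim (\<lambda>n. f (r n) e)" for e
  have lim: "(\<lambda>n. f (r n) e) \<longlonglongrightarrow> h e" if "e \<in> edges G" for e
    using r(2) that by (simp add: h_def convergent_LIMSEQ_iff)
  have wlim: "(\<lambda>n. weighted_degree G (f (r n)) v) \<longlonglongrightarrow> weighted_degree G h v" for v
    unfolding weighted_degree_def by (intro tendsto_sum lim) (simp add: incident_edges_def)
  have "h \<in> ?K"
    unfolding admissible_weights_def
  proof (intro CollectI conjI ballI)
    fix e assume e: "e \<in> edges G"
    show "0 \<le> h e" by (rule LIMSEQ_le_const[OF lim[OF e]]) (use f(1) e in \<open>auto simp: admissible_weights_def\<close>)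
    show "h e \<le> 1" by (rule LIMSEQ_le_const2[OF lim[OF e]]) (use f(1) e in \<open>auto simp: admissible_weights_def\<close>)
  next
    fix v assume "v \<in> verts G"
    thus "weighted_degree G h v \<le> b"
      by (intro LIMSEQ_le_const2[OF wlim]) (use f(1) in \<open>auto simp: admissible_weights_def\<close>)
  qed
  moreover have "?\<phi> g \<le> ?\<phi> h" if "g \<in> ?K" for g
  proof -
    have "?\<phi> g \<le> M" unfolding M_def by (rule cSUP_upper[OF that bdd])
    also have "M \<le> ?\<phi> h"
    proof (rule LIMSEQ_le)
      show "(\<lambda>n. M - 1 / Suc (r n)) \<longlonglongrightarrow> M"
        using LIMSEQ_subseq_LIMSEQ[OF LIMSEQ_inverse_real_of_nat_add_minus[of M] r(1)]
        by (simp add: o_def inverse_eq_divide)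
      show "(\<lambda>n. ?\<phi> (f (r n))) \<longlonglongrightarrow> ?\<phi> h"
        unfolding covered_demand_def by (intro tendsto_sum tendsto_min tendsto_const wlim)
      show "\<exists>N. \<forall>n\<ge>N. M - 1 / Suc (r n) \<le> ?\<phi> (f (r n))"
        using f(2) less_imp_le by blast
    qed
    finally show ?thesis .
  qed
  ultimately show ?thesis using that by blast
qed

section \<open>Infinitesimal changes of the weights\<close>

lemma eventually_perturbed_less:
  fixes x y c :: real
  assumes "x < c"
  shows "eventually (\<lambda>\<epsilon>. x + \<epsilon> * y < c) (at_right 0)"
proof -
  have "((\<lambda>\<epsilon>. x + \<epsilon> * y) \<longlongrightarrow> x + 0 * y) (at_right 0)"
    by (intro tendsto_intros)
  thus ?thesis using assms order_tendstoD(2) by fastforce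
qed

text \<open>A strict inequality survives every small change, so the sign of the slope matters only
  where the constraint is tight.\<close>

lemma eventually_perturbed_le:
  fixes x y c :: real
  assumes "x \<le> c" "x = c \<Longrightarrow> y \<le> 0"
  shows "eventually (\<lambda>\<epsilon>. x + \<epsilon> * y \<le> c) (at_right 0)"
proof (cases "x = c")
  case True
  show ?thesis
    using eventually_at_right_less[of "0::real"]
    by eventually_elim (use assms True in \<open>auto simp: mult_nonneg_nonpos\<close>)
next
  case False
  with assms eventually_perturbed_less[of x c y] show ?thesis
    by (auto elim: eventually_mono)
qed

text \<open>Above \<open>c\<close> the truncation hides small changes, so the slope is constrained
  only for \<open>x\<close> at most \<open>c\<close>.\<close>

lemma eventually_perturbed_min:
  fixes x y c :: real
  assumes "x \<le> c \<Longrightarrow> 0 \<le> y"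
  shows "eventually (\<lambda>\<epsilon>. min c x \<le> min c (x + \<epsilon> * y)) (at_right 0)"
proof (cases "x \<le> c")
  case True
  show ?thesis
    using eventually_at_right_less[of "0::real"]
    by eventually_elim (use assms True in \<open>auto simp: min_def\<close>)
next
  case False
  have "eventually (\<lambda>\<epsilon>. (-x) + \<epsilon> * (-y) < -c) (at_right 0)"
    using False by (intro eventually_perturbed_less) auto
  thus ?thesis by eventually_elim (use False in auto)
qed

text \<open>For weights in [0,1] this is the tangent cone of the cube of weights at
  \<open>h\<close>. Its closure under addition lets alternating changes be built edge by
  edge.\<close>

definition feasible_direction :: "'v graph \<Rightarrow> ('v set \<Rightarrow> real) \<Rightarrow> ('v set \<Rightarrow> real) \<Rightarrow> bool" where
  "feasible_direction G h g \<longleftrightarrow>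
    (\<forall>e\<in>edges G. (h e = 0 \<longrightarrow> 0 \<le> g e) \<and> (h e = 1 \<longrightarrow> g e \<le> 0))"

lemma feasible_direction_add:
  "feasible_direction G h f \<Longrightarrow> feasible_direction G h g \<Longrightarrow> feasible_direction G h (\<lambda>e. f e + g e)"
  by (auto simp: feasible_direction_def add_nonneg_nonneg add_nonpos_nonpos)

text \<open>Moving from \<open>h\<close> by a small positive multiple of \<open>g\<close> keeps all
  constraints, lowers no truncated degree and strictly raises the one at \<open>u\<close>. Finitely
  many conditions are involved, so one step size serves them all.\<close>

lemma not_max_covered_demand:
  assumes G: "simple_graph G" and h: "h \<in> admissible_weights b G"
    and g: "feasible_direction G h g"
    and up: "\<And>v. v \<in> verts G \<Longrightarrow> weighted_degree G h v = b \<Longrightarrow> weighted_degree G g v \<le> 0"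
    and down: "\<And>v. v \<in> verts G \<Longrightarrow> weighted_degree G h v \<le> a \<Longrightarrow> weighted_degree G g v \<ge> 0"
    and u: "u \<in> verts G" "weighted_degree G h u < a" "weighted_degree G g u > 0"
  shows "\<exists>f\<in>admissible_weights b G. covered_demand a G h < covered_demand a G f"
proof -
  let ?d = "weighted_degree G"
  have hE: "0 \<le> h e" "h e \<le> 1" if "e \<in> edges G" for e
    using h that by (auto simp: admissible_weights_def)
  have fin: "finite (verts G)" using G by (simp add: simple_graph_def)
  have 1: "\<forall>\<^sub>F \<epsilon> in at_right 0. \<forall>e\<in>edges G. h e + \<epsilon> * g e \<le> 1"
    using g hE finite_edges[OF G]
    by (intro eventually_ball_finite ballI eventually_perturbed_le) (auto simp: feasible_direction_def)
  \<comment> \<open>Nonnegativity is written as an upper bound on the negated weight, so that the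
    same perturbation lemma applies.\<close>
  have 2: "\<forall>\<^sub>F \<epsilon> in at_right 0. \<forall>e\<in>edges G. - h e + \<epsilon> * - g e \<le> 0"
    using g hE finite_edges[OF G]
    by (intro eventually_ball_finite ballI eventually_perturbed_le) (auto simp: feasible_direction_def)
  have 3: "\<forall>\<^sub>F \<epsilon> in at_right 0. \<forall>v\<in>verts G. ?d h v + \<epsilon> * ?d g v \<le> b"
    using up h fin
    by (intro eventually_ball_finite ballI eventually_perturbed_le) (auto simp: admissible_weights_def)
  have 4: "\<forall>\<^sub>F \<epsilon> in at_right 0. \<forall>v\<in>verts G. min a (?d h v) \<le> min a (?d h v + \<epsilon> * ?d g v)"
    using down fin by (intro eventually_ball_finite ballI eventually_perturbed_min) auto
  have "\<forall>\<^sub>F \<epsilon> in at_right (0::real). 0 < \<epsilon>" by (rule eventually_at_right_less)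
  with 1 2 3 4 have "\<forall>\<^sub>F \<epsilon> in at_right (0::real). \<exists>f\<in>admissible_weights b G. covered_demand a G h < covered_demand a G f"
  proof eventually_elim
    case (elim \<epsilon>)
    let ?f = "\<lambda>e. h e + \<epsilon> * g e"
    have d: "?d ?f v = ?d h v + \<epsilon> * ?d g v" for v
      by (simp add: weighted_degree_add weighted_degree_scale)
    have "?f \<in> admissible_weights b G"
      unfolding admissible_weights_def mem_Collect_eq d
      using elim(1,2,3) by (force simp: algebra_simps)
    moreover have "covered_demand a G h < covered_demand a G ?f"
      unfolding covered_demand_def d
    proof (rule sum_strict_mono_ex1[OF fin])
      have "0 < \<epsilon> * ?d g u" using elim u by simp
      hence "min (real a) (?d h u) < min (real a) (?d h u + \<epsilon> * ?d g u)" using u(2) by simp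
      thus "\<exists>v\<in>verts G. min (real a) (?d h v) < min (real a) (?d h v + \<epsilon> * ?d g v)" using u(1) by blast
    qed (use elim in blast)
    ultimately show ?case by blast
  qed
  thus ?thesis using eventually_happens trivial_limit_at_right_real by blast
qed

section \<open>Alternating changes and the violating pair\<close>

text \<open>Double counting: an edge contributes once for each of its ends in
  \<open>A\<close>.\<close>

lemma sum_incident_edges:
  fixes f :: "'v set \<Rightarrow> real"
  assumes "simple_graph G" "finite A"
  shows "(\<Sum>v\<in>A. \<Sum>e\<in>incident_edges G v. f e) = (\<Sum>e\<in>edges G. f e * card (e \<inter> A))"
proof -
  have "(\<Sum>v\<in>A. \<Sum>e\<in>incident_edges G v. f e) = (\<Sum>v\<in>A. \<Sum>e\<in>edges G. if v \<in> e then f e else 0)"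
    unfolding incident_edges_def
    by (intro sum.cong refl sum.inter_filter finite_edges assms)
  also have "\<dots> = (\<Sum>e\<in>edges G. \<Sum>v\<in>A. if v \<in> e then f e else 0)" by (rule sum.swap)
  also have "\<dots> = (\<Sum>e\<in>edges G. f e * card (e \<inter> A))"
  proof (rule sum.cong[OF refl])
    fix e
    have "(\<Sum>v\<in>A. if v \<in> e then f e else 0) = (\<Sum>v\<in>{v\<in>A. v \<in> e}. f e)"
      by (rule sum.inter_filter[symmetric, OF assms(2)])
    also have "{v\<in>A. v \<in> e} = e \<inter> A" by blast
    finally show "(\<Sum>v\<in>A. if v \<in> e then f e else 0) = f e * card (e \<inter> A)" by simp
  qed
  finally show ?thesis .
qed

theorem fractional_factor_criterion:
  assumes G: "simple_graph G" and ab: "a \<le> b"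
    and crit: "\<And>S T. S \<subseteq> verts G \<Longrightarrow> T \<subseteq> verts G \<Longrightarrow> S \<inter> T = {} \<Longrightarrow>
      a * card T \<le> b * card S + (\<Sum>v\<in>T. card {e \<in> incident_edges G v. e \<inter> S = {}})"
  shows "\<exists>h. fractional_factor a b G h"
proof -
  let ?d = "weighted_degree G"
  obtain h where h: "h \<in> admissible_weights b G"
    and max: "\<And>g. g \<in> admissible_weights b G \<Longrightarrow> covered_demand a G g \<le> covered_demand a G h"
    using ex_max_covered_demand[OF G] by blast
  have hE: "0 \<le> h e" "h e \<le> 1" if "e \<in> edges G" for e
    using h that by (auto simp: admissible_weights_def)
  have hb: "?d h v \<le> b" if "v \<in> verts G" for v
    using h that by (auto simp: admissible_weights_def)
  have fin: "finite (verts G)" using G by (simp add: simple_graph_def)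
  have "a \<le> ?d h u" if u: "u \<in> verts G" for u
  proof (rule ccontr)
    assume "\<not> a \<le> ?d h u"
    hence ua: "?d h u < a" by simp
    have no_improvement: False
      if "feasible_direction G h g"
        "\<And>v. v \<in> verts G \<Longrightarrow> ?d h v = b \<Longrightarrow> ?d g v \<le> 0"
        "\<And>v. v \<in> verts G \<Longrightarrow> ?d h v \<le> a \<Longrightarrow> ?d g v \<ge> 0"
        "?d g u > 0" for g
      using not_max_covered_demand[OF G h that(1-3) u ua that(4)] max by fastforce
    \<comment> \<open>\<open>A\<close> holds the vertices that can pass a unit of weight to
      \<open>u\<close>, and \<open>B\<close> those that can gain a unit together with
      \<open>u\<close>. They play the role of the even and odd ends of alternating walks from
      \<open>u\<close>; directions replace the walks, so repeated edges need no bookkeeping.\<close>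
    define A where "A = {v \<in> verts G. \<exists>g. feasible_direction G h g \<and>
      (\<forall>x\<in>verts G. ?d g x = of_bool (x = u) - of_bool (x = v))}"
    define B where "B = {w \<in> verts G. \<exists>g. feasible_direction G h g \<and>
      (\<forall>x\<in>verts G. ?d g x = of_bool (x = u) + of_bool (x = w))}"
    have AV: "A \<subseteq> verts G" and BV: "B \<subseteq> verts G" by (auto simp: A_def B_def)
    hence finA: "finite A" and finB: "finite B" using fin finite_subset by blast+
    have "feasible_direction G h (\<lambda>_. 0)" "?d (\<lambda>_. 0) x = 0" for x
      by (auto simp: feasible_direction_def weighted_degree_def)
    hence uA: "u \<in> A" using u unfolding A_def by auto
    \<comment> \<open>Raising the unsaturated edge repays the unit lost at \<open>v\<close> and
      gives one to \<open>w\<close>.\<close>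
    have AB: "w \<in> B" if "v \<in> A" and e: "{v, w} \<in> edges G" "h {v, w} < 1" for v w
    proof -
      obtain g where g: "feasible_direction G h g"
        "\<And>x. x \<in> verts G \<Longrightarrow> ?d g x = of_bool (x = u) - of_bool (x = v)"
        using \<open>v \<in> A\<close> by (auto simp: A_def)
      let ?k = "\<lambda>e. 1 * of_bool (e = {v, w}) :: real"
      have "feasible_direction G h ?k" using e by (auto simp: feasible_direction_def)
      hence "feasible_direction G h (\<lambda>e. g e + ?k e)" by (rule feasible_direction_add[OF g(1)])
      moreover have "v \<noteq> w" "w \<in> verts G" using G e(1) by (auto simp: simple_graph_def)
      moreover have "?d (\<lambda>e. g e + ?k e) x = of_bool (x = u) + of_bool (x = w)" if "x \<in> verts G" for x
        unfolding weighted_degree_add weighted_degree_indicator[OF G e(1)] g(2)[OF that]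
        using \<open>v \<noteq> w\<close> by auto
      ultimately show ?thesis unfolding B_def by blast
    qed
    \<comment> \<open>Lowering an edge of positive weight cancels the gain at \<open>w\<close> and
      takes a unit from \<open>v\<close>.\<close>
    have BA: "v \<in> A" if "w \<in> B" and e: "{w, v} \<in> edges G" "h {w, v} > 0" for v w
    proof -
      obtain g where g: "feasible_direction G h g"
        "\<And>x. x \<in> verts G \<Longrightarrow> ?d g x = of_bool (x = u) + of_bool (x = w)"
        using \<open>w \<in> B\<close> by (auto simp: B_def)
      let ?k = "\<lambda>e. (-1) * of_bool (e = {w, v}) :: real"
      have "feasible_direction G h ?k" using e by (auto simp: feasible_direction_def)
      hence "feasible_direction G h (\<lambda>e. g e + ?k e)" by (rule feasible_direction_add[OF g(1)])
      moreover have "v \<noteq> w" "v \<in> verts G" using G e(1) by (auto simp: simple_graph_def)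
      moreover have "?d (\<lambda>e. g e + ?k e) x = of_bool (x = u) - of_bool (x = v)" if "x \<in> verts G" for x
        unfolding weighted_degree_add weighted_degree_indicator[OF G e(1)] g(2)[OF that]
        using \<open>v \<noteq> w\<close> by auto
      ultimately show ?thesis unfolding A_def by blast
    qed
    \<comment> \<open>If \<open>w\<close> had room below b, then \<open>u\<close> and
      \<open>w\<close> could gain together, with no degree decreasing.\<close>
    have Bb: "?d h w = b" if "w \<in> B" for w
    proof (rule ccontr)
      assume nb: "?d h w \<noteq> b"
      obtain g where g: "feasible_direction G h g"
        "\<And>x. x \<in> verts G \<Longrightarrow> ?d g x = of_bool (x = u) + of_bool (x = w)"
        using \<open>w \<in> B\<close> by (auto simp: B_def)
      show False
        by (rule no_improvement[OF g(1)]) (use g(2) ua ab nb u in auto)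
    qed
    \<comment> \<open>A vertex above a could give weight to \<open>u\<close> without lowering its
      truncated degree.\<close>
    have Aa: "?d h v \<le> a" if "v \<in> A" for v
    proof (rule ccontr)
      assume na: "\<not> ?d h v \<le> a"
      obtain g where g: "feasible_direction G h g"
        "\<And>x. x \<in> verts G \<Longrightarrow> ?d g x = of_bool (x = u) - of_bool (x = v)"
        using \<open>v \<in> A\<close> by (auto simp: A_def)
      show False
        by (rule no_improvement[OF g(1)]) (use g(2) ua ab na u in auto)
    qed
    \<comment> \<open>At a common vertex the loss and the gain cancel when the two directions are
      added, leaving a gain of 2 at \<open>u\<close> alone.\<close>
    have disj: "B \<inter> A = {}"
    proof (rule ccontr)
      assume "B \<inter> A \<noteq> {}"
      then obtain v where "v \<in> A" "v \<in> B" by blast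
      then obtain f g where
        f: "feasible_direction G h f" "\<And>x. x \<in> verts G \<Longrightarrow> ?d f x = of_bool (x = u) - of_bool (x = v)" and
        g: "feasible_direction G h g" "\<And>x. x \<in> verts G \<Longrightarrow> ?d g x = of_bool (x = u) + of_bool (x = v)"
        by (auto simp: A_def B_def)
      have "?d (\<lambda>e. f e + g e) x = 2 * of_bool (x = u)" if "x \<in> verts G" for x
        by (simp add: weighted_degree_add f(2) g(2) that)
      thus False
        using ua ab u by (intro no_improvement[OF feasible_direction_add[OF f(1) g(1)]]) auto
    qed
    \<comment> \<open>By \<open>AB\<close>, an edge at \<open>A\<close> that avoids \<open>B\<close>
      has weight 1; so the degree sum over \<open>A\<close> splits into a count of those edges and
      the weight between \<open>A\<close> and \<open>B\<close>.\<close>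
    let ?f1 = "\<lambda>e. of_bool (e \<inter> B = {}) :: real" and ?f2 = "\<lambda>e. h e * of_bool (e \<inter> B \<noteq> {})"
    have "?d h v = (\<Sum>e\<in>incident_edges G v. ?f1 e) + (\<Sum>e\<in>incident_edges G v. ?f2 e)"
      if v: "v \<in> A" for v
      unfolding weighted_degree_def sum.distrib[symmetric]
    proof (rule sum.cong[OF refl])
      fix e assume "e \<in> incident_edges G v"
      hence e: "e \<in> edges G" "v \<in> e" by (auto simp: incident_edges_def)
      obtain w where w: "e = {v, w}" by (rule edge_otherE[OF G e])
      show "h e = ?f1 e + ?f2 e"
        using AB[OF v, of w] e(1) hE(2)[OF e(1)] by (fastforce simp: w)
    qed
    hence "(\<Sum>v\<in>A. ?d h v) = (\<Sum>v\<in>A. \<Sum>e\<in>incident_edges G v. ?f1 e) + (\<Sum>v\<in>A. \<Sum>e\<in>incident_edges G v. ?f2 e)"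
      by (simp add: sum.distrib)
    also have "(\<Sum>v\<in>A. \<Sum>e\<in>incident_edges G v. ?f1 e) = (\<Sum>v\<in>A. card {e \<in> incident_edges G v. e \<inter> B = {}})"
      unfolding of_nat_sum
      by (intro sum.cong refl) (simp add: finite_incident_edges[OF G] Int_def)
    \<comment> \<open>By \<open>BA\<close> and disjointness, an edge of positive weight meeting
      \<open>B\<close> has exactly one end in \<open>B\<close> and one in \<open>A\<close>, so both
      sums count its weight once.\<close>
    also have "(\<Sum>v\<in>A. \<Sum>e\<in>incident_edges G v. ?f2 e) = (\<Sum>w\<in>B. ?d h w)"
      unfolding weighted_degree_def sum_incident_edges[OF G finA] sum_incident_edges[OF G finB]
    proof (rule sum.cong[OF refl])
      fix e assume e: "e \<in> edges G"
      show "?f2 e * card (e \<inter> A) = h e * card (e \<inter> B)"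
      proof (cases "h e = 0 \<or> e \<inter> B = {}")
        case False
        then obtain w where w: "w \<in> e" "w \<in> B" by blast
        obtain v where v: "e = {w, v}" using edge_otherE[OF G e w(1)] by blast
        have "v \<in> A" using BA[OF w(2), of v] False hE(1)[OF e] e by (simp add: v)
        hence "e \<inter> A = {v}" "e \<inter> B = {w}" using w disj by (auto simp: v)
        thus ?thesis by simp
      qed auto
    qed
    also have "(\<Sum>w\<in>B. ?d h w) = b * card B" using Bb by simp
    finally have "(\<Sum>v\<in>A. ?d h v) = real (b * card B + (\<Sum>v\<in>A. card {e \<in> incident_edges G v. e \<inter> B = {}}))"
      by simp
    also have "\<dots> \<ge> real (a * card A)"
      using crit[OF BV AV disj] by (simp only: of_nat_le_iff)
    finally have "real (a * card A) \<le> (\<Sum>v\<in>A. ?d h v)" .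
    \<comment> \<open>No vertex of \<open>A\<close> exceeds a, and \<open>u\<close> falls strictly
      short. This contradicts the criterion for the pair \<open>B\<close>, \<open>A\<close>.\<close>
    moreover have "(\<Sum>v\<in>A. ?d h v) < (\<Sum>v\<in>A. real a)"
      by (rule sum_strict_mono_ex1[OF finA]) (use Aa ua uA in auto)
    ultimately show False by (simp add: mult.commute)
  qed
  thus ?thesis
    using hE hb unfolding fractional_factor_def weighted_degree_def by blast
qed

section \<open>Bounds on the signless Laplacian spectral radius\<close>

abbreviation vertex_degree :: "'v graph \<Rightarrow> 'v \<Rightarrow> nat" where
  "vertex_degree G v \<equiv> card (incident_edges G v)"

definition neighbours :: "'v graph \<Rightarrow> 'v \<Rightarrow> 'v set" where
  "neighbours G v = {w \<in> verts G. {v, w} \<in> edges G}"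

lemma neighbours_subset:
  "simple_graph G \<Longrightarrow> neighbours G v \<subseteq> verts G - {v}"
  by (auto simp: neighbours_def simple_graph_def)

lemma card_incident_edges:
  assumes "simple_graph G"
  shows "vertex_degree G v = card (neighbours G v)"
proof -
  have "bij_betw (\<lambda>w. {v, w}) (neighbours G v) (incident_edges G v)"
  proof (rule bij_betw_imageI)
    show "inj_on (\<lambda>w. {v, w}) (neighbours G v)"
      by (auto simp: inj_on_def doubleton_eq_iff)
    show "(\<lambda>w. {v, w}) ` neighbours G v = incident_edges G v"
    proof (intro equalityI subsetI)
      fix e assume "e \<in> incident_edges G v"
      hence e: "e \<in> edges G" "v \<in> e" by (auto simp: incident_edges_def)
      obtain w where "e = {v, w}" "w \<in> verts G" by (rule edge_otherE[OF assms e])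
      thus "e \<in> (\<lambda>w. {v, w}) ` neighbours G v" using e by (auto simp: neighbours_def)
    qed (auto simp: neighbours_def incident_edges_def)
  qed
  thus ?thesis by (metis bij_betw_same_card)
qed

lemma sum_neighbours:
  fixes p :: "'v \<Rightarrow> real"
  assumes "finite (verts G)"
  shows "(\<Sum>w\<in>verts G. if {v, w} \<in> edges G then p w else 0) = (\<Sum>w\<in>neighbours G v. p w)"
  unfolding neighbours_def by (rule sum.inter_filter[symmetric, OF assms])

section \<open>Comparing the radius with test vectors\<close>

lemma signless_radius_in_spectrum:
  assumes "simple_graph G" "verts G \<noteq> {}"
  shows "signless_radius G \<in> spectrum (signless_laplacian G (vertex_enum G))"
  unfolding signless_radius_def
  using vertex_enum(2)[OF assms(1)] assms(2)
  by (intro Max_in finite_spectrum_signless_laplacian spectrum_signless_laplacian_nonempty) auto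

lemma signless_radius_ge:
  assumes "simple_graph G" "\<exists>v\<in>verts G. p v \<noteq> 0"
    and "\<And>v. v \<in> verts G \<Longrightarrow> real (vertex_degree G v) * p v + (\<Sum>w\<in>neighbours G v. p w) = c * p v"
  shows "c \<le> signless_radius G"
  unfolding signless_radius_def
proof (rule Max_ge[OF finite_spectrum_signless_laplacian])
  have "finite (verts G)" using assms(1) by (simp add: simple_graph_def)
  thus "c \<in> spectrum (signless_laplacian G (vertex_enum G))"
    using assms(2,3) unfolding spectrum_signless_laplacian[OF vertex_enum[OF assms(1)]]
    by (intro CollectI exI[of _ p]) (simp add: sum_neighbours)
qed

text \<open>The Collatz--Wielandt bound: compare an eigenvector with the positive vector p at a vertex
  where the ratio is largest.\<close>

lemma signless_radius_le:
  assumes G: "simple_graph G" and "verts G \<noteq> {}"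
    and p: "\<And>v. v \<in> verts G \<Longrightarrow> p v > 0"
    and super: "\<And>v. v \<in> verts G \<Longrightarrow> real (vertex_degree G v) * p v + (\<Sum>w\<in>neighbours G v. p w) \<le> c * p v"
  shows "signless_radius G \<le> c"
proof -
  let ?k = "signless_radius G"
  have fin: "finite (verts G)" using G by (simp add: simple_graph_def)
  from signless_radius_in_spectrum[OF assms(1,2)]
  obtain x where x: "\<exists>v\<in>verts G. x v \<noteq> 0"
    and eq: "\<And>v. v \<in> verts G \<Longrightarrow> real (vertex_degree G v) * x v + (\<Sum>w\<in>neighbours G v. x w) = ?k * x v"
    unfolding spectrum_signless_laplacian[OF vertex_enum[OF G]] sum_neighbours[OF fin] by blast
  define M where "M = Max ((\<lambda>v. \<bar>x v\<bar> / p v) ` verts G)"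
  have "M \<in> (\<lambda>v. \<bar>x v\<bar> / p v) ` verts G"
    unfolding M_def using fin assms(2) by (intro Max_in) auto
  then obtain v where v: "v \<in> verts G" "M = \<bar>x v\<bar> / p v" by blast
  have M: "\<bar>x w\<bar> \<le> M * p w" if "w \<in> verts G" for w
  proof -
    have "\<bar>x w\<bar> / p w \<le> M" unfolding M_def using fin that by (intro Max_ge) auto
    thus ?thesis using p[OF that] by (simp add: field_simps)
  qed
  have xv: "\<bar>x v\<bar> = M * p v" using v p[OF v(1)] by simp
  have "M > 0"
  proof -
    obtain w where w: "w \<in> verts G" "x w \<noteq> 0" using x by blast
    hence "0 < M * p w" using M[OF w(1)] by linarith
    thus ?thesis using p[OF w(1)] by (simp add: zero_less_mult_iff)
  qed
  \<comment> \<open>Taking absolute values makes the estimate independent of the signs of the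
    eigenvalue and of the entries of \<open>x\<close>.\<close>
  have "?k * \<bar>x v\<bar> \<le> \<bar>?k * x v\<bar>" by (simp add: abs_mult mult_right_mono)
  also have "\<dots> = \<bar>real (vertex_degree G v) * x v + (\<Sum>w\<in>neighbours G v. x w)\<bar>"
    by (simp only: eq[OF v(1)])
  also have "\<dots> \<le> real (vertex_degree G v) * \<bar>x v\<bar> + (\<Sum>w\<in>neighbours G v. \<bar>x w\<bar>)"
    by (rule order.trans[OF abs_triangle_ineq]) (simp add: abs_mult sum_abs)
  also have "\<dots> \<le> real (vertex_degree G v) * (M * p v) + (\<Sum>w\<in>neighbours G v. M * p w)"
    unfolding xv using M by (intro add_left_mono sum_mono) (auto simp: neighbours_def)
  also have "\<dots> = M * (real (vertex_degree G v) * p v + (\<Sum>w\<in>neighbours G v. p w))"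
    by (simp add: algebra_simps sum_distrib_left)
  also have "\<dots> \<le> M * (c * p v)"
    using super[OF v(1)] \<open>M > 0\<close> by (intro mult_left_mono) auto
  finally have "?k * (M * p v) \<le> c * (M * p v)" by (simp add: xv algebra_simps)
  thus ?thesis using \<open>M > 0\<close> p[OF v(1)] by simp
qed

section \<open>The radius and the degree sum\<close>

text \<open>A path to any other vertex starts with an edge at \<open>v\<close>. This makes the
  degrees a positive test vector.\<close>

lemma connected_degree_pos:
  assumes G: "simple_graph G" and "connected_graph G" "graph_order G \<ge> 2" "v \<in> verts G"
  shows "vertex_degree G v > 0"
proof -
  have fin: "finite (verts G)" using G by (simp add: simple_graph_def)
  have "verts G \<noteq> {v}" using assms(3) by (auto simp: graph_order_def)
  then obtain u where u: "u \<in> verts G" "u \<noteq> v" using assms(4) by blast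
  have "(v, u) \<in> {(x, y). {x, y} \<in> edges G}\<^sup>*"
    using assms(2,4) u by (auto simp: connected_graph_def)
  then obtain w where "{v, w} \<in> edges G"
    using u(2) by (auto elim: converse_rtranclE)
  hence "{v, w} \<in> incident_edges G v" by (simp add: incident_edges_def)
  thus ?thesis using finite_incident_edges[OF G] by (auto simp: card_gt_0_iff)
qed

lemma degree_le:
  assumes "simple_graph G" "v \<in> verts G"
  shows "vertex_degree G v \<le> graph_order G - 1"
proof -
  have "finite (verts G)" using assms(1) by (simp add: simple_graph_def)
  hence "card (neighbours G v) \<le> card (verts G - {v})"
    using neighbours_subset[OF assms(1)] by (intro card_mono) auto
  thus ?thesis using assms \<open>finite (verts G)\<close> by (simp add: card_incident_edges graph_order_def)
qed

text \<open>The Feng--Yu bound, with the degree sum in place of twice the number of edges; the positive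
  vector in the Collatz--Wielandt bound is the vector of degrees.\<close>

lemma signless_radius_le_degree_sum:
  assumes G: "simple_graph G" and con: "connected_graph G" and n: "graph_order G = n" "n \<ge> 2"
  shows "signless_radius G \<le> (\<Sum>v\<in>verts G. real (vertex_degree G v)) / (real n - 1) + (real n - 2)"
proof (rule signless_radius_le[OF G, where p = "\<lambda>v. real (vertex_degree G v)"])
  show "verts G \<noteq> {}" using con by (simp add: connected_graph_def)
  show pos: "0 < real (vertex_degree G v)" if "v \<in> verts G" for v
    using connected_degree_pos[OF G con _ that] n by simp
  have fin: "finite (verts G)" using G by (simp add: simple_graph_def)
  fix v assume v: "v \<in> verts G"
  define D where "D = (\<Sum>v\<in>verts G. real (vertex_degree G v))"
  define N where "N = real n - 1"
  define d where "d = real (vertex_degree G v)"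
  define \<Sigma> where "\<Sigma> = (\<Sum>w\<in>neighbours G v. real (vertex_degree G w))"
  have N: "N > 0" and d: "d > 0" using n pos[OF v] by (auto simp: N_def d_def)
  have le_N: "real (vertex_degree G w) \<le> N" if "w \<in> verts G" for w
    using degree_le[OF G that] n unfolding N_def by linarith
  hence dN: "d \<le> N" using v by (simp add: d_def)
  have cN: "real (card (neighbours G v)) = d" by (simp add: d_def card_incident_edges[OF G])
  have "\<Sigma> \<le> (\<Sum>w\<in>neighbours G v. N)"
    unfolding \<Sigma>_def using le_N by (intro sum_mono) (auto simp: neighbours_def)
  hence S1: "\<Sigma> \<le> d * N" by (simp add: cN)
  let ?R = "verts G - {v} - neighbours G v"
  have sub: "neighbours G v \<subseteq> verts G - {v}" by (rule neighbours_subset[OF G])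
  have "D = d + (\<Sum>w\<in>verts G - {v}. real (vertex_degree G w))"
    unfolding D_def d_def by (rule sum.remove[OF fin v])
  also have "(\<Sum>w\<in>verts G - {v}. real (vertex_degree G w)) = (\<Sum>w\<in>?R. real (vertex_degree G w)) + \<Sigma>"
    unfolding \<Sigma>_def using fin sub by (intro sum.subset_diff) auto
  finally have D: "D = d + ((\<Sum>w\<in>?R. real (vertex_degree G w)) + \<Sigma>)" .
  have "real (card ?R) = N - d"
  proof -
    have "card ?R = card (verts G - {v}) - card (neighbours G v)"
      using sub fin finite_subset by (intro card_Diff_subset) blast+
    moreover have "card (neighbours G v) \<le> card (verts G - {v})"
      using sub fin by (intro card_mono) auto
    moreover have "real (card (verts G - {v})) = N"
      using v fin n by (simp add: N_def graph_order_def)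
    ultimately show ?thesis using cN by linarith
  qed
  \<comment> \<open>Each of the \<open>N - d\<close> non-neighbours has degree at least 1, which
    together with \<open>d\<close> itself takes at least \<open>N\<close> out of the total
    \<open>D\<close>.\<close>
  moreover have "(\<Sum>w\<in>?R. 1) \<le> (\<Sum>w\<in>?R. real (vertex_degree G w))"
    using connected_degree_pos[OF G con] n by (intro sum_mono) (auto simp: Suc_le_eq)
  ultimately have S2: "\<Sigma> \<le> D - N" using D by simp
  \<comment> \<open>The smaller of the bounds \<open>S1\<close> and \<open>S2\<close> is used. For
    \<open>S2\<close>, the difference of the two sides times \<open>N\<close> is exactly the product
    \<open>(N - d) * (d * N - (D - N))\<close>.\<close>
  have "d * d + \<Sigma> \<le> (D / N + (N - 1)) * d"
  proof (cases "D - N \<le> d * N")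
    case True
    have "0 \<le> (N - d) * (d * N - (D - N))" using True dN by (intro mult_nonneg_nonneg) auto
    hence "(d * d + (D - N)) * N \<le> D * d + (N - 1) * d * N" by (simp add: algebra_simps)
    also have "\<dots> = ((D / N + (N - 1)) * d) * N" using N by (simp add: distrib_right)
    finally have "(d * d + (D - N)) * N \<le> ((D / N + (N - 1)) * d) * N" .
    hence "d * d + (D - N) \<le> (D / N + (N - 1)) * d" using N by simp
    thus ?thesis using S2 by linarith
  next
    case False
    hence "d + 1 \<le> D / N" using N by (simp add: field_simps)
    hence "(d + 1 + (N - 1)) * d \<le> (D / N + (N - 1)) * d"
      using d by (intro mult_right_mono) auto
    thus ?thesis using S1 by (simp add: algebra_simps)
  qed
  thus "real (vertex_degree G v) * real (vertex_degree G v) + (\<Sum>w\<in>neighbours G v. real (vertex_degree G w))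
     \<le> ((\<Sum>v\<in>verts G. real (vertex_degree G v)) / (real n - 1) + (real n - 2)) * real (vertex_degree G v)"
    by (simp add: D_def N_def d_def \<Sigma>_def)
qed

section \<open>Adjacency in joins and unions of complete graphs\<close>

lemma simple_complete_graph: "simple_graph (complete_graph m)"
  by (simp add: simple_graph_def complete_graph_def)

lemma simple_disjoint_union:
  "simple_graph G \<Longrightarrow> simple_graph H \<Longrightarrow> simple_graph (disjoint_union G H)"
  by (auto simp: simple_graph_def disjoint_union_def card_image)

lemma simple_graph_join:
  assumes "simple_graph G" "simple_graph H"
  shows "simple_graph (graph_join G H)"
  using assms by (fastforce simp: simple_graph_def graph_join_def disjoint_union_def card_image)

lemma Inl_image_eq_iff: "{Inl u, Inl v} = Inl ` e \<longleftrightarrow> e = {u, v}"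
  and Inr_image_eq_iff: "{Inr u, Inr v} = Inr ` e \<longleftrightarrow> e = {u, v}"
  using inj_image_eq_iff[of Inl e "{u, v}"] inj_image_eq_iff[of Inr e "{u, v}"] by auto

lemma disjoint_union_edge_iff:
  "{Inl u, Inl v} \<in> edges (disjoint_union G H) \<longleftrightarrow> {u, v} \<in> edges G"
  "{Inr x, Inr y} \<in> edges (disjoint_union G H) \<longleftrightarrow> {x, y} \<in> edges H"
  "{Inl u, Inr y} \<notin> edges (disjoint_union G H)"
  "{Inr y, Inl u} \<notin> edges (disjoint_union G H)"
  by (auto simp: disjoint_union_def image_iff Inl_image_eq_iff Inr_image_eq_iff)

lemma graph_join_edge_iff:
  "{Inl u, Inl v} \<in> edges (graph_join G H) \<longleftrightarrow> {u, v} \<in> edges G"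
  "{Inr x, Inr y} \<in> edges (graph_join G H) \<longleftrightarrow> {x, y} \<in> edges H"
  "{Inl u, Inr y} \<in> edges (graph_join G H) \<longleftrightarrow> u \<in> verts G \<and> y \<in> verts H"
  "{Inr y, Inl u} \<in> edges (graph_join G H) \<longleftrightarrow> u \<in> verts G \<and> y \<in> verts H"
  by (auto simp: graph_join_def disjoint_union_edge_iff doubleton_eq_iff)

lemma complete_graph_edge_iff:
  "{i, j} \<in> edges (complete_graph m) \<longleftrightarrow> i < m \<and> j < m \<and> i \<noteq> j"
  by (auto simp: complete_graph_def card_2_iff doubleton_eq_iff)

lemma verts_constructions:
  "verts (complete_graph m) = {..<m}"
  "verts (disjoint_union G H) = verts G <+> verts H"
  "verts (graph_join G H) = verts G <+> verts H"
  by (simp_all add: complete_graph_def disjoint_union_def graph_join_def)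

section \<open>The radius of the extremal graph\<close>

lemma sum_lessThan_if_neq:
  fixes y :: real
  assumes "i < m"
  shows "(\<Sum>j<m. if i \<noteq> j then y else 0) = (real m - 1) * y"
proof -
  have "(\<Sum>j<m. if i \<noteq> j then y else 0) = (\<Sum>j<m. y - (if i = j then y else 0))"
    by (intro sum.cong) auto
  also have "\<dots> = (real m - 1) * y" using assms by (simp add: sum_subtractf algebra_simps)
  finally show ?thesis .
qed

text \<open>An eigenvector of the extremal graph is sought constant on the three vertex classes; its
  values solve the equations below, which reduce to a cubic in the eigenvalue.\<close>

lemma extremal_eigenvector_values:
  fixes a n :: nat
  assumes a: "a > 0" and n: "n \<ge> a + 2"
  obtains \<rho> x y z :: real where "x > 0" "y > 0" "z > 0"
    "(real n - 1) * x + ((real a - 1) * x + (real n - real a - 1) * y + z) = \<rho> * x"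
    "(real n - 2) * y + (real a * x + (real n - real a - 2) * y) = \<rho> * y"
    "real a * z + real a * x = \<rho> * z"
proof -
  define A N where "A = real a" and "N = real n"
  have A: "A > 0" and N: "N \<ge> A + 2" using a n by (auto simp: A_def N_def)
  \<comment> \<open>With \<open>x = 1\<close> on the join side, the last two equations give
    \<open>y\<close> and \<open>z\<close> as functions of the eigenvalue q; substituting them in the
    first and clearing denominators leaves this cubic.\<close>
  define P where "P q = (q - (N + A - 2)) * (q - (2 * N - A - 4)) * (q - A)
     - (N - A - 1) * A * (q - A) - A * (q - (2 * N - A - 4))" for q :: real
  have "P (2 * N - 4) = - A * (2 * N - 4)" by (simp add: P_def algebra_simps)
  hence 1: "P (2 * N - 4) \<le> 0" using A N by (simp add: mult_nonneg_nonneg)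
  have "P (2 * N - 2) = (2 * N - 2 - A) * (2 * N - A) - A * (A + 2)" by (simp add: P_def algebra_simps)
  moreover have "A * (A + 2) \<le> (2 * N - A) * (2 * N - 2 - A)" using A N by (intro mult_mono) auto
  ultimately have 2: "P (2 * N - 2) \<ge> 0" by (simp add: mult.commute)
  \<comment> \<open>A root of at least \<open>2 * N - 4\<close> keeps both denominators positive,
    hence also \<open>y\<close> and \<open>z\<close>.\<close>
  have "\<exists>q\<ge>2 * N - 4. q \<le> 2 * N - 2 \<and> P q = 0"
    by (rule IVT'[of P, OF 1 2]) (auto simp: P_def intro!: continuous_intros)
  then obtain q where q: "q \<ge> 2 * N - 4" "P q = 0" by blast
  have pos: "q - A > 0" "q - (2 * N - A - 4) > 0" using q A N by auto
  define y z where "y = A / (q - (2 * N - A - 4))" and "z = A / (q - A)"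
  have y: "(q - (2 * N - A - 4)) * y = A" and z: "(q - A) * z = A"
    using pos by (auto simp: y_def z_def)
  have "(q - (2 * N - A - 4)) * (q - A) * (q - (N + A - 2) - (N - A - 1) * y - z)
      = (q - (N + A - 2)) * (q - (2 * N - A - 4)) * (q - A)
     - (N - A - 1) * ((q - (2 * N - A - 4)) * y) * (q - A) - ((q - A) * z) * (q - (2 * N - A - 4))"
    by (simp add: algebra_simps)
  also have "\<dots> = P q" unfolding y z P_def ..
  finally have "q - (N + A - 2) - (N - A - 1) * y - z = 0" using q(2) pos by simp
  hence "(real n - 1) * 1 + ((real a - 1) * 1 + (real n - real a - 1) * y + z) = q * 1"
    by (simp add: A_def N_def)
  moreover have "y > 0" "z > 0" using pos A by (auto simp: y_def z_def)
  ultimately show ?thesis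
    using y z by (intro that[of 1 y z q]) (simp_all add: A_def N_def algebra_simps)
qed

text \<open>The three equations are the eigenvalue equation at a vertex of the joined clique (value
  \<open>x\<close>), of the large clique (\<open>y\<close>) and at the single vertex
  (\<open>z\<close>); \<open>x > 0\<close> makes the vector nonzero.\<close>

lemma signless_radius_extremal_ge:
  fixes a n :: nat and x y z \<rho> :: real
  assumes a: "a > 0" and n: "n \<ge> a + 2" and x: "x > 0"
    and eqs: "(real n - 1) * x + ((real a - 1) * x + (real n - real a - 1) * y + z) = \<rho> * x"
    "(real n - 2) * y + (real a * x + (real n - real a - 2) * y) = \<rho> * y"
    "real a * z + real a * x = \<rho> * z"
  shows "\<rho> \<le> signless_radius (graph_join (complete_graph a)
             (disjoint_union (complete_graph (n - a - 1)) (complete_graph 1)))"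
    (is "_ \<le> signless_radius ?H")
proof (rule signless_radius_ge)
  show H: "simple_graph ?H"
    by (intro simple_graph_join simple_disjoint_union simple_complete_graph)
  define p :: "nat + (nat + nat) \<Rightarrow> real"
    where "p = case_sum (\<lambda>_. x) (case_sum (\<lambda>_. y) (\<lambda>_. z))"
  have p: "p (Inl i) = x" "p (Inr (Inl j)) = y" "p (Inr (Inr k)) = z" for i j k
    by (simp_all add: p_def)
  have fin: "finite (verts ?H)" using H by (simp add: simple_graph_def)
  have "Inl 0 \<in> verts ?H" "p (Inl 0) \<noteq> 0" using a x by (auto simp: p verts_constructions)
  thus "\<exists>v\<in>verts ?H. p v \<noteq> 0" by blast
  have m: "real (n - Suc a) = real n - real a - 1" using n by linarith
  have sum_H: "(\<Sum>w\<in>neighbours ?H v. f w) =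
      (\<Sum>i<a. if {v, Inl i} \<in> edges ?H then f (Inl i) else 0) +
      ((\<Sum>j<n - a - 1. if {v, Inr (Inl j)} \<in> edges ?H then f (Inr (Inl j)) else 0) +
       (if {v, Inr (Inr 0)} \<in> edges ?H then f (Inr (Inr 0)) else 0))" for v and f :: "_ \<Rightarrow> real"
    unfolding sum_neighbours[OF fin, symmetric] verts_constructions
    by (simp add: sum.Plus o_def)
  \<comment> \<open>The degree is the neighbour sum of the constant 1, so one formula for neighbour
    sums serves both terms of the equation.\<close>
  have deg: "real (vertex_degree ?H v) = (\<Sum>w\<in>neighbours ?H v. 1)" for v
    unfolding card_incident_edges[OF H] by simp
  have mem: "Inl j \<in> X <+> Y \<longleftrightarrow> j \<in> X" "Inr k \<in> X <+> Y \<longleftrightarrow> k \<in> Y"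
    for j k and X Y :: "nat set" by auto
  note edge = mem graph_join_edge_iff disjoint_union_edge_iff complete_graph_edge_iff verts_constructions
  fix v assume "v \<in> verts ?H"
  then consider i where "v = Inl i" "i < a" | j where "v = Inr (Inl j)" "j < n - a - 1" | "v = Inr (Inr 0)"
    by (auto simp: verts_constructions)
  thus "real (vertex_degree ?H v) * p v + (\<Sum>w\<in>neighbours ?H v. p w) = \<rho> * p v"
  proof cases
    case 1
    have "(\<Sum>w\<in>neighbours ?H v. f w) = (real a - 1) * c + ((real n - real a - 1) * d + f (Inr (Inr 0)))"
      if "\<And>i. f (Inl i) = c" "\<And>j. f (Inr (Inl j)) = d" for f c d
      unfolding sum_H using 1 that
      by (simp add: edge sum_lessThan_if_neq m cong: sum.cong_simp if_cong)
    note sum = this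
    show ?thesis
      unfolding deg sum[of "\<lambda>_. 1" 1 1, OF refl refl] sum[of p x y, OF p(1) p(2)]
      using eqs(1) by (simp add: p 1(1) algebra_simps)
  next
    case 2
    have "(\<Sum>w\<in>neighbours ?H v. f w) = real a * c + (real n - real a - 2) * d"
      if "\<And>i. f (Inl i) = c" "\<And>j. f (Inr (Inl j)) = d" for f c d
      unfolding sum_H using 2 that
      by (simp add: edge sum_lessThan_if_neq m cong: sum.cong_simp if_cong)
    note sum = this
    show ?thesis
      unfolding deg sum[of "\<lambda>_. 1" 1 1, OF refl refl] sum[of p x y, OF p(1) p(2)]
      using eqs(2) by (simp add: p 2(1) algebra_simps)
  next
    case 3
    have "(\<Sum>w\<in>neighbours ?H v. f w) = real a * c"
      if "\<And>i. f (Inl i) = c" for f c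
      unfolding sum_H using 3 that
      by (simp add: edge del: insert_absorb2 cong: sum.cong_simp if_cong)
    note sum = this
    show ?thesis
      unfolding deg sum[of "\<lambda>_. 1" 1, OF refl] sum[of p x, OF p(1)]
      using eqs(3) by (simp add: p 3(1) algebra_simps)
  qed
qed

text \<open>A vertex of degree at most a places G inside the extremal graph. Carried over to G, the
  positive eigenvector there loses only nonnegative terms, so it satisfies the Collatz-Wielandt
  inequality with the same \<rho>.\<close>

lemma signless_radius_le_extremal:
  fixes a n :: nat
  assumes G: "simple_graph G" and n: "graph_order G = n" "n \<ge> a + 2" and a: "a > 0"
    and v0: "v0 \<in> verts G" "vertex_degree G v0 \<le> a"
  shows "signless_radius G \<le> signless_radius (graph_join (complete_graph a)
             (disjoint_union (complete_graph (n - a - 1)) (complete_graph 1)))"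
proof -
  obtain \<rho> x y z :: real where pos: "x > 0" "y > 0" "z > 0" and eqs:
    "(real n - 1) * x + ((real a - 1) * x + (real n - real a - 1) * y + z) = \<rho> * x"
    "(real n - 2) * y + (real a * x + (real n - real a - 2) * y) = \<rho> * y"
    "real a * z + real a * x = \<rho> * z"
    using extremal_eigenvector_values[OF a n(2)] .
  have fin: "finite (verts G)" using G by (simp add: simple_graph_def)
  have cV: "card (verts G) = n" using n by (simp add: graph_order_def)
  note sub = neighbours_subset[OF G]
  have "card (neighbours G v0) \<le> a" using v0 by (simp add: card_incident_edges[OF G])
  moreover have "a \<le> card (verts G - {v0})" using v0 fin cV n by simp
  \<comment> \<open>The neighbourhood of \<open>v0\<close> is padded to exactly a vertices, which
    stand for the joined clique.\<close>
  ultimately obtain A where A: "neighbours G v0 \<subseteq> A" "A \<subseteq> verts G - {v0}" "card A = a"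
    using exists_subset_between[of "neighbours G v0" a "verts G - {v0}"] sub fin by auto
  have finA: "finite A" using A fin finite_subset by blast
  define B where "B = verts G - {v0} - A"
  have finB: "finite B" using fin by (simp add: B_def)
  have cB: "real (card B) = real n - real a - 1"
  proof -
    have "card B = n - 1 - a" unfolding B_def using A finA v0 cV by (simp add: card_Diff_subset)
    thus ?thesis using n by linarith
  qed
  have V: "verts G = insert v0 (A \<union> B)" "v0 \<notin> A" "v0 \<notin> B" "A \<inter> B = {}"
    using v0 A by (auto simp: B_def)
  define p where "p v = (if v = v0 then z else if v \<in> A then x else y)" for v
  have pA: "p v = x" if "v \<in> A" for v using that V by (auto simp: p_def)
  have pB: "p v = y" if "v \<in> B" for v using that V by (auto simp: p_def)
  have p0: "p v0 = z" by (simp add: p_def)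
  have ppos: "p v > 0" for v using pos by (simp add: p_def)
  have sumA: "(\<Sum>w\<in>A. p w) = real a * x" using pA A by simp
  have sumB: "(\<Sum>w\<in>B. p w) = (real n - real a - 1) * y" using pB cB by simp
  have bound: "real (vertex_degree G v) * p v + (\<Sum>w\<in>neighbours G v. p w) \<le> real (card U) * p v + (\<Sum>w\<in>U. p w)"
    if "neighbours G v \<subseteq> U" "finite U" for v U
    using that ppos less_imp_le
    by (intro add_mono mult_right_mono sum_mono2) (auto simp: card_incident_edges[OF G] card_mono less_imp_le)
  have "signless_radius G \<le> \<rho>"
  proof (rule signless_radius_le[OF G])
    show "verts G \<noteq> {}" using v0 by blast
    show "p v > 0" for v by (rule ppos)
    fix v assume "v \<in> verts G"
    then consider "v = v0" | "v \<in> A" | "v \<in> B" using V by blast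
    thus "real (vertex_degree G v) * p v + (\<Sum>w\<in>neighbours G v. p w) \<le> \<rho> * p v"
    proof cases
      case 1
      show ?thesis using bound[of v0 A] A finA eqs(3) by (simp add: 1 sumA p0)
    next
      case 2
      have "neighbours G v \<subseteq> verts G - {v}" by (rule sub)
      moreover have "(\<Sum>w\<in>verts G - {v}. p w) = (real a - 1) * x + (real n - real a - 1) * y + z"
      proof -
        have "(\<Sum>w\<in>verts G. p w) = z + (real a * x + (real n - real a - 1) * y)"
          using V finA finB by (simp add: sum.union_disjoint sumA sumB p0)
        thus ?thesis using \<open>v \<in> verts G\<close> fin by (simp add: sum_diff1 pA 2 algebra_simps)
      qed
      moreover have "real (card (verts G - {v})) = real n - 1"
        using \<open>v \<in> verts G\<close> fin cV n by simp
      ultimately show ?thesis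
        using bound[of v "verts G - {v}"] fin eqs(1) by (simp add: pA 2)
    next
      case 3
      \<comment> \<open>A vertex of \<open>B\<close> misses \<open>v0\<close> as well as itself,
        whence the \<open>n - 2\<close> in the second equation.\<close>
      have "v \<notin> neighbours G v0" using A(1) 3 V by blast
      hence "v0 \<notin> neighbours G v"
        using \<open>v \<in> verts G\<close> by (simp add: neighbours_def insert_commute)
      hence "neighbours G v \<subseteq> A \<union> (B - {v})" using sub[of v] by (auto simp: B_def)
      moreover have "(\<Sum>w\<in>A \<union> (B - {v}). p w) = real a * x + (real n - real a - 2) * y"
      proof -
        have "(\<Sum>w\<in>A \<union> (B - {v}). p w) = (\<Sum>w\<in>A. p w) + (\<Sum>w\<in>B - {v}. p w)"
          using V finA finB by (intro sum.union_disjoint) auto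
        moreover have "(\<Sum>w\<in>B - {v}. p w) = (real n - real a - 2) * y"
          using sum.remove[OF finB 3, of p] unfolding sumB pB[OF 3] by (simp add: algebra_simps)
        ultimately show ?thesis by (simp only: sumA)
      qed
      moreover have "real (card (A \<union> (B - {v}))) = real n - 2"
      proof -
        have "card (A \<union> (B - {v})) = card A + card (B - {v})"
          using V finA finB by (intro card_Un_disjoint) auto
        moreover have "card B > 0" using 3 finB by (auto simp: card_gt_0_iff)
        ultimately show ?thesis using 3 finB cB A(3) by simp
      qed
      ultimately show ?thesis
        using bound[of v "A \<union> (B - {v})"] finA finB eqs(2) by (simp add: pB 3)
    qed
  qed
  also have "\<rho> \<le> signless_radius (graph_join (complete_graph a)
             (disjoint_union (complete_graph (n - a - 1)) (complete_graph 1)))"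
    by (rule signless_radius_extremal_ge[OF a n(2) pos(1) eqs])
  finally show ?thesis .
qed

section \<open>Fractional deleted graphs\<close>

text \<open>Here s and t are the sizes of S and T, and f is the degree sum over T after removing e
  and S. The lower bounds on f come from the minimum degree of G - e, from that of G with two edge
  ends lost, and from the number of missing edges. Integers allow negative differences.\<close>

lemma deletion_inequality:
  fixes a b n s t f :: int
  assumes a: "1 \<le> a" and b: "a \<le> b" "3 \<le> b" and n: "7 \<le> n" and st: "0 \<le> s" "0 \<le> t" "s + t \<le> n"
    and f: "t * (a - s) \<le> f" "t * (a + 1 - s) - 2 \<le> f" "t * (n - 1 - s) - (2 * n - 2 - a) \<le> f"
  shows "a * t \<le> b * s + f"
proof (cases "t \<le> b \<or> s = 0")
  case True
  have "t * s \<le> b * s" using True st by (auto intro: mult_right_mono)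
  thus ?thesis using f(1) by (simp add: algebra_simps)
next
  case False
  hence t: "b + 1 \<le> t" and s: "1 \<le> s" using st by auto
  \<comment> \<open>The slacks in \<open>t >= a + 1\<close> and \<open>s + t <= n\<close>; in these
    terms the third bound on \<open>f\<close> factors.\<close>
  define j r where "j = t - 1 - a" and "r = n - s - t"
  have jr: "0 \<le> j" "0 \<le> r" using t b st by (auto simp: j_def r_def)
  have "b * s + (t * (n - 1 - s) - (2 * n - 2 - a)) - a * t = (t - 2) * (j + r) - a + (b - 2) * s"
    by (simp add: j_def r_def algebra_simps)
  hence F: "(t - 2) * (j + r) - a + (b - 2) * s \<le> b * s + f - a * t" using f(3) by linarith
  show ?thesis
  proof (cases "j + r \<ge> 1")
    case True
    have "(t - 2) * 1 \<le> (t - 2) * (j + r)" using True t b by (intro mult_left_mono) auto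
    moreover have "(b - 2) * 1 \<le> (b - 2) * s" using b s by (intro mult_left_mono) auto
    moreover have "a \<le> (t - 2) * 1 + (b - 2) * 1" using t b by simp
    ultimately have "a \<le> (t - 2) * (j + r) + (b - 2) * s" by (meson add_mono order_trans)
    hence "0 \<le> (t - 2) * (j + r) - a + (b - 2) * s" by (simp only: diff_add_eq diff_ge_0_iff_ge)
    hence "0 \<le> b * s + f - a * t" using F by (rule order_trans)
    thus ?thesis by simp
  next
    case False
    \<comment> \<open>The tight case: S and T cover all vertices and
      \<open>t = a + 1 = b + 1\<close>. The third bound then needs \<open>(b - 2) * s >= a\<close>,
      true for \<open>s >= 3\<close>, and for \<open>s = 2\<close> because \<open>n >= 7\<close>
      forces \<open>a >= 4\<close>. For \<open>s = 1\<close> the second bound is used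
      instead.\<close>
    hence "j = 0" "r = 0" using jr by auto
    hence ta: "t = a + 1" "n = s + t" "b = a" using t b by (auto simp: j_def r_def)
    consider "s = 1" | "s = 2" | "s \<ge> 3" using s by linarith
    thus ?thesis
    proof cases
      case 1
      thus ?thesis using f(2) ta b by (simp add: algebra_simps)
    next
      case 2
      hence "a \<ge> 4" using n ta by simp
      thus ?thesis using F 2 ta \<open>j = 0\<close> \<open>r = 0\<close> by simp
    next
      case 3
      have "(b - 2) * 3 \<le> (b - 2) * s" using b 3 by (intro mult_left_mono) auto
      thus ?thesis using F ta b \<open>j = 0\<close> \<open>r = 0\<close> by simp
    qed
  qed
qed

section \<open>From degree conditions to deleted factors\<close>

lemma vertex_degree_delete_edge:
  assumes "simple_graph G" "e \<in> edges G"
  shows "vertex_degree G v = vertex_degree (delete_edge G e) v + of_bool (v \<in> e)"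
proof -
  have eq: "incident_edges (delete_edge G e) v = incident_edges G v - {e}"
    by (auto simp: incident_edges_def delete_edge_def)
  show ?thesis
  proof (cases "v \<in> e")
    case True
    hence "e \<in> incident_edges G v" using assms by (simp add: incident_edges_def)
    thus ?thesis using True card_Suc_Diff1[OF finite_incident_edges[OF assms(1)]] eq by simp
  next
    case False
    hence "e \<notin> incident_edges G v" by (simp add: incident_edges_def)
    thus ?thesis using False eq by simp
  qed
qed

text \<open>In a simple graph each vertex of S accounts for at most one edge at
  \<open>v\<close>.\<close>

lemma vertex_degree_le_avoiding:
  assumes G: "simple_graph G" and S: "finite S" "v \<notin> S"
  shows "vertex_degree G v \<le> card {e \<in> incident_edges G v. e \<inter> S = {}} + card S"
proof -
  let ?I = "incident_edges G v"
  have "{e \<in> ?I. e \<inter> S \<noteq> {}} \<subseteq> (\<lambda>w. {v, w}) ` S"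
  proof
    fix e assume "e \<in> {e \<in> ?I. e \<inter> S \<noteq> {}}"
    hence e: "e \<in> edges G" "v \<in> e" "e \<inter> S \<noteq> {}" by (auto simp: incident_edges_def)
    obtain w where "e = {v, w}" by (rule edge_otherE[OF G e(1,2)])
    thus "e \<in> (\<lambda>w. {v, w}) ` S" using e(3) S(2) by auto
  qed
  hence "card {e \<in> ?I. e \<inter> S \<noteq> {}} \<le> card S"
    using S(1) by (rule surj_card_le[rotated])
  moreover have "card ?I = card ({e \<in> ?I. e \<inter> S = {}} \<union> {e \<in> ?I. e \<inter> S \<noteq> {}})"
    by (rule arg_cong[of _ _ card]) blast
  moreover note card_Un_le[of "{e \<in> ?I. e \<inter> S = {}}" "{e \<in> ?I. e \<inter> S \<noteq> {}}"]
  ultimately show ?thesis by linarith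
qed

text \<open>The degree sum falls short of \<open>n * (n - 1)\<close> by at most
  \<open>2 * n - 4 - a\<close>; deleting e adds 2, which gives the constant
  \<open>2 * n - 2 - a\<close> in \<open>deletion_inequality\<close>.\<close>

lemma fractional_deleted_of_degrees:
  fixes a b n :: nat
  assumes G: "simple_graph G" and n: "graph_order G = n" "7 \<le> n"
    and ab: "1 \<le> a" "a \<le> b" "3 \<le> b"
    and min_degree: "\<And>v. v \<in> verts G \<Longrightarrow> a + 1 \<le> vertex_degree G v"
    and degree_sum: "(n - 1) * (n - 2) + a + 2 \<le> (\<Sum>v\<in>verts G. vertex_degree G v)"
  shows "fractional_deleted a b G"
  unfolding fractional_deleted_def
proof
  fix e assume e: "e \<in> edges G"
  let ?G = "delete_edge G e"
  have G': "simple_graph ?G" and V': "verts ?G = verts G"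
    using G by (auto simp: simple_graph_def delete_edge_def)
  have fin: "finite (verts G)" using G by (simp add: simple_graph_def)
  have e2: "e \<subseteq> verts G" "card e = 2" using G e by (auto simp: simple_graph_def)
  have sum_deleted: "(\<Sum>v\<in>U. vertex_degree G v) = (\<Sum>v\<in>U. vertex_degree ?G v) + card (U \<inter> e)"
    if "finite U" for U
  proof -
    have "(\<Sum>v\<in>U. vertex_degree G v) = (\<Sum>v\<in>U. vertex_degree ?G v) + (\<Sum>v\<in>U. of_bool (v \<in> e))"
      unfolding vertex_degree_delete_edge[OF G e] by (rule sum.distrib)
    thus ?thesis using that by (simp add: Int_def)
  qed
  show "\<exists>h. fractional_factor a b ?G h"
  proof (rule fractional_factor_criterion[OF G' ab(2)])
    fix S T assume "S \<subseteq> verts ?G" "T \<subseteq> verts ?G" and disj: "S \<inter> T = {}"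
    hence ST: "S \<subseteq> verts G" "T \<subseteq> verts G" by (simp_all add: V')
    hence finST: "finite S" "finite T" using fin finite_subset by blast+
    define f where "f = (\<Sum>v\<in>T. card {e' \<in> incident_edges ?G v. e' \<inter> S = {}})"
    define D where "D = (\<Sum>v\<in>T. vertex_degree ?G v)"
    have "card S + card T = card (S \<union> T)" using disj finST by (simp add: card_Un_disjoint)
    also have "\<dots> \<le> n" using ST fin n by (auto simp: graph_order_def intro!: card_mono)
    finally have stn: "card S + card T \<le> n" .
    have "D \<le> (\<Sum>v\<in>T. card {e' \<in> incident_edges ?G v. e' \<inter> S = {}} + card S)"
      unfolding D_def using disj finST by (intro sum_mono vertex_degree_le_avoiding[OF G']) auto
    hence Df: "D \<le> f + card T * card S" by (simp add: f_def sum.distrib)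
    have ge_a: "a \<le> vertex_degree ?G v" if "v \<in> verts G" for v
      using min_degree[OF that] vertex_degree_delete_edge[OF G e, of v] by (cases "v \<in> e") auto
    have "(\<Sum>v\<in>T. a) \<le> D" unfolding D_def using ST ge_a by (intro sum_mono) auto
    hence D1: "card T * a \<le> D" by simp
    have "(\<Sum>v\<in>T. a + 1) \<le> (\<Sum>v\<in>T. vertex_degree G v)" using ST min_degree by (intro sum_mono) auto
    moreover have "card (T \<inter> e) \<le> 2"
      using card_mono[of e "T \<inter> e"] e2 fin finite_subset by fastforce
    ultimately have D2: "card T * (a + 1) \<le> D + 2"
      using sum_deleted[OF finST(2)] by (simp add: D_def)
    \<comment> \<open>Bounding the degrees outside T by \<open>n - 1\<close> charges the whole
      shortfall to T; the 2 counts the ends of e.\<close>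
    have "(\<Sum>v\<in>verts G. vertex_degree G v) = D + (\<Sum>v\<in>verts G - T. vertex_degree ?G v) + 2"
      using sum_deleted[OF fin] e2 ST fin sum.subset_diff[OF ST(2) fin, of "vertex_degree ?G"]
      by (simp add: D_def Int_absorb1)
    also have "(\<Sum>v\<in>verts G - T. vertex_degree ?G v) \<le> (\<Sum>v\<in>verts G - T. n - 1)"
      using degree_le[OF G'] n by (intro sum_mono) (auto simp: V' graph_order_def)
    also have "\<dots> = (n - card T) * (n - 1)"
      using ST finST n by (simp add: card_Diff_subset graph_order_def)
    finally have "(n - 1) * (n - 2) + a + 2 \<le> D + (n - card T) * (n - 1) + 2"
      using degree_sum by linarith
    hence "int ((n - 1) * (n - 2) + a + 2) \<le> int (D + (n - card T) * (n - 1) + 2)"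
      by (simp only: of_nat_le_iff)
    hence D3: "(int n - 1) * (int n - 2) + int a \<le> int D + (int n - int (card T)) * (int n - 1)"
      using n stn by simp
    have Dfi: "int D \<le> int f + int (card T) * int (card S)"
      using Df by (metis of_nat_add of_nat_le_iff of_nat_mult)
    have D1i: "int (card T) * int a \<le> int D" using D1 by (metis of_nat_le_iff of_nat_mult)
    have D2i: "int (card T) * (int a + 1) \<le> int D + 2"
      using D2 by (metis of_nat_1 of_nat_add of_nat_le_iff of_nat_mult of_nat_numeral)
    have "int a * int (card T) \<le> int b * int (card S) + int f"
    proof (rule deletion_inequality[of _ _ "int n"])
      show "int (card T) * (int a - int (card S)) \<le> int f"
        using D1i Dfi by (simp add: algebra_simps)
      show "int (card T) * (int a + 1 - int (card S)) - 2 \<le> int f"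
        using D2i Dfi by (simp add: algebra_simps)
      show "int (card T) * (int n - 1 - int (card S)) - (2 * int n - 2 - int a) \<le> int f"
        using D3 Dfi by (simp add: algebra_simps)
    qed (use ab n stn in auto)
    hence "a * card T \<le> b * card S + f"
      by (metis of_nat_add of_nat_le_iff of_nat_mult)
    thus "a * card T \<le> b * card S + (\<Sum>v\<in>T. card {e' \<in> incident_edges ?G v. e' \<inter> S = {}})"
      by (simp add: f_def)
  qed
qed

theorem theorem1p6:
  fixes a b n :: nat and G :: "'v graph"
  assumes "a > 0" and "b > 0" and "b \<ge> max a 3"
    and "simple_graph G" and "connected_graph G" and "graph_order G = n"
    and "n \<ge> max (a + 2) 7"
    and "signless_radius G > 2 * real n - 4 + (real a + 1) / (real n - 1)"
    and "signless_radius G >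
           signless_radius (graph_join (complete_graph a)
             (disjoint_union (complete_graph (n - a - 1)) (complete_graph 1)))"
  shows "fractional_deleted a b G"
proof (rule fractional_deleted_of_degrees)
  show "simple_graph G" "graph_order G = n" "7 \<le> n" "1 \<le> a" "a \<le> b" "3 \<le> b"
    using assms by auto
  show "a + 1 \<le> vertex_degree G v" if "v \<in> verts G" for v
    \<comment> \<open>A vertex of degree at most a would bound the radius by that of the extremal
      graph.\<close>
    using signless_radius_le_extremal[OF assms(4,6) _ assms(1) that] assms(7,9) by force
  define D where "D = (\<Sum>v\<in>verts G. vertex_degree G v)"
  have n: "real n - 1 > 0" using assms(7) by auto
  have "signless_radius G \<le> real D / (real n - 1) + (real n - 2)"
    using signless_radius_le_degree_sum[OF assms(4,5,6)] assms(7) by (simp add: D_def)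
  hence "real n - 2 + (real a + 1) / (real n - 1) < real D / (real n - 1)"
    using assms(8) by linarith
  hence "(real n - 2 + (real a + 1) / (real n - 1)) * (real n - 1) < real D / (real n - 1) * (real n - 1)"
    using n by (rule mult_strict_right_mono)
  moreover have "(real a + 1) / (real n - 1) * (real n - 1) = real a + 1"
    "real D / (real n - 1) * (real n - 1) = real D" using n by simp_all
  ultimately have "(real n - 2) * (real n - 1) + (real a + 1) < real D"
    by (simp only: distrib_right)
  hence "real ((n - 1) * (n - 2) + a + 1) < real D"
    using assms(7) by (simp add: mult.commute)
  \<comment> \<open>Both sides are integers, so the strict inequality with \<open>a + 1\<close>
    yields \<open>a + 2\<close>.\<close>
  thus "(n - 1) * (n - 2) + a + 2 \<le> (\<Sum>v\<in>verts G. vertex_degree G v)"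
    unfolding of_nat_less_iff D_def by simp
qed

end
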